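(* Let $G$ be a finite simple graph and $k$ a nonnegative integer. Suppose that $G$ has a subgraph $G_1$ with $k(G_1) \le k$ and a chordal subgraph $G_2$ such that $E(G_1) \cup E(G_2) = E(G)$ and $X := V(G_1) \cap V(G_2)$ is a clique of $G_2$. Then $k(G) \le k+1$.
   Context: For an acyclic digraph $D$, the competition graph $C(D)$ is the graph with vertex set $V(D)$ in which distinct vertices $x,y$ are adjacent if and only if there is a vertex $v$ with $(x,v)$ and $(y,v)$ both arcs of $D$. For a graph $G$, the competition number $k(G)$ is the smallest nonnegative integer $k$ such that $G$ together with $k$ new isolated vertices is the competition graph of some acyclic digraph. A graph is chordal if it has no induced cycle of length at least $4$. A clique is a set of pairwise adjacent vertices. *)

theory Defs
  imports "Graph_Theory.Graph_Theory"
begin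

text \<open>
  A finite simple graph is a \<^locale>\<open>pair_graph\<close>: a finite, loop-free, symmetric relation, so that
  an edge \<open>xy\<close> is the pair of arcs \<open>(x, y)\<close>, \<open>(y, x)\<close>. Digraphs use the same record type.
\<close>

definition competition_graph :: "'a pair_pre_digraph \<Rightarrow> 'a pair_pre_digraph" where
  "competition_graph D =
    \<lparr> pverts = pverts D,
      parcs = {(x, y). x \<in> pverts D \<and> y \<in> pverts D \<and> x \<noteq> y \<and>
                 (\<exists>v \<in> pverts D. (x, v) \<in> parcs D \<and> (y, v) \<in> parcs D)} \<rparr>"

text \<open>The disjoint sum with \<^typ>\<open>nat\<close> provides new vertices even if \<^typ>\<open>'a\<close> is finite.\<close>

definition add_isolated :: "nat \<Rightarrow> 'a pair_pre_digraph \<Rightarrow> ('a + nat) pair_pre_digraph" where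
  "add_isolated k G =
    \<lparr> pverts = pverts G <+> {..<k},
      parcs = map_prod Inl Inl ` parcs G \<rparr>"

definition competition_number :: "'a pair_pre_digraph \<Rightarrow> nat" where
  "competition_number G =
    (LEAST k. \<exists>D. pair_fin_digraph D \<and> acyclic (parcs D) \<and> competition_graph D = add_isolated k G)"

text \<open>
  The \<open>LEAST\<close> above is attained for every finite simple graph: give each arc its own new vertex as
  common prey of the two ends.
\<close>

lemma competition_number_exists:
  fixes G :: "'a pair_pre_digraph"
  assumes "pair_graph G"
  shows "\<exists>k D. pair_fin_digraph D \<and> acyclic (parcs D) \<and> competition_graph D = add_isolated k G"
proof -
  interpret pair_graph G by fact
  obtain f where f: "bij_betw f (parcs G) {..<card (parcs G)}"
    using pair_finite_arcs ex_bij_betw_finite_nat[of "parcs G"] by (auto simp: lessThan_atLeast0)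
  have inj: "e = e'" if "e \<in> parcs G" "e' \<in> parcs G" "f e = f e'" for e e'
    using f that by (auto simp: bij_betw_def inj_on_def)
  have ran: "f e < card (parcs G)" if "e \<in> parcs G" for e
    using f that by (auto simp: bij_betw_def)
  define A :: "('a + nat) rel" where "A = (\<lambda>e. (Inl (fst e), Inr (f e))) ` parcs G \<union> (\<lambda>e. (Inl (snd e), Inr (f e))) ` parcs G"
  define D where "D = \<lparr> pverts = pverts G <+> {..<card (parcs G)}, parcs = A \<rparr>"
  have "pair_fin_digraph D"
    using pair_finite_verts pair_finite_arcs
    by unfold_locales (auto simp: D_def A_def ran arc_fst_in_verts arc_snd_in_verts intro: in_arcsD1 in_arcsD2)
  moreover have "acyclic (parcs D)"
  proof -
    have "parcs D O parcs D = {}" by (auto simp: D_def A_def)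
    then have "(parcs D)\<^sup>+ = parcs D"
      by (intro trancl_id) (auto simp: trans_def)
    then show ?thesis by (auto simp: acyclic_def D_def A_def)
  qed
  moreover have "competition_graph D = add_isolated (card (parcs G)) G"
  proof -
    have "(x, y) \<in> map_prod Inl Inl ` parcs G"
      if "x \<noteq> y" "(x, v) \<in> A" "(y, v) \<in> A" for x y v
    proof -
      from that(2) obtain e where e: "e \<in> parcs G" "v = Inr (f e)" "x = Inl (fst e) \<or> x = Inl (snd e)"
        by (auto simp: A_def)
      from that(3) obtain e' where e': "e' \<in> parcs G" "v = Inr (f e')" "y = Inl (fst e') \<or> y = Inl (snd e')"
        by (auto simp: A_def)
      have "e' = e" using e e' inj by auto
      moreover have "(snd e, fst e) \<in> parcs G" using e(1) arcs_symmetric by (cases e) auto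
      ultimately show ?thesis
        using that(1) e e' by (cases e) (auto simp: image_iff intro: bexI[rotated])
    qed
    moreover have "(Inl u, Inr (f (u, v))) \<in> A" "(Inl v, Inr (f (u, v))) \<in> A" if "(u, v) \<in> parcs G" for u v
      using that by (force simp: A_def)+
    moreover have "x \<in> pverts D \<and> v \<in> pverts D" if "(x, v) \<in> A" for x v
      using that by (auto simp: A_def D_def ran arc_fst_in_verts arc_snd_in_verts intro: in_arcsD1 in_arcsD2)
    ultimately have "{(x, y). x \<in> pverts D \<and> y \<in> pverts D \<and> x \<noteq> y \<and>
                 (\<exists>v \<in> pverts D. (x, v) \<in> A \<and> (y, v) \<in> A)} = map_prod Inl Inl ` parcs G"
      using no_loops' by (fastforce)
    then show ?thesis by (simp add: competition_graph_def add_isolated_def D_def)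
  qed
  ultimately show ?thesis by blast
qed

definition clique :: "'a pair_pre_digraph \<Rightarrow> 'a set \<Rightarrow> bool" where
  "clique G X \<longleftrightarrow> X \<subseteq> pverts G \<and> (\<forall>x \<in> X. \<forall>y \<in> X. x \<noteq> y \<longrightarrow> (x, y) \<in> parcs G)"

text \<open>The vertices of an induced cycle, listed in cyclic order.\<close>

definition induced_cycle :: "'a pair_pre_digraph \<Rightarrow> 'a list \<Rightarrow> bool" where
  "induced_cycle G vs \<longleftrightarrow>
    3 \<le> length vs \<and> distinct vs \<and> set vs \<subseteq> pverts G \<and>
    (\<forall>i < length vs. \<forall>j < length vs.
       (vs ! i, vs ! j) \<in> parcs G \<longleftrightarrow> j = Suc i mod length vs \<or> i = Suc j mod length vs)"

definition chordal :: "'a pair_pre_digraph \<Rightarrow> bool" where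
  "chordal G \<longleftrightarrow> \<not> (\<exists>vs. induced_cycle G vs \<and> 4 \<le> length vs)"

end

theory Submission
  imports Defs
begin

text \<open>
  By Dirac's argument a chordal graph has a simplicial vertex outside any clique that does not
  contain all its vertices, so \<open>G\<^sub>2\<close> arises from the clique \<open>X\<close> by successively adding vertices
  whose earlier neighbours form a clique. Start with a digraph for \<open>G\<^sub>1\<close> plus isolated vertices and
  a new sink \<open>t\<close> with in-neighbourhood \<open>X\<close>. Whenever a vertex \<open>v\<close> is added, let \<open>v\<close> play the role of
  the old sink and introduce a new sink whose in-neighbours are \<open>v\<close> and its earlier neighbours.
  Each new sink adds exactly the edges of the clique preying on it, so a single additional isolated
  vertex, the last sink, suffices.
\<close>

section \<open>Simplicial vertices of chordal graphs\<close>

text \<open>A walk of least length works: if \<open>f i = f j\<close> with \<open>i < j\<close>, or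
  if an arc led from \<open>f i\<close> to \<open>f j\<close> with \<open>j > Suc i\<close>, joining
  the prefix up to \<open>i\<close> to the suffix from \<open>j\<close> would give a shorter
  walk.\<close>

lemma rtrancl_shortest_path:
  assumes "(x, y) \<in> R\<^sup>*"
  obtains f n where "f 0 = x" "f n = y" "inj_on f {..n}" "\<And>i. i < n \<Longrightarrow> (f i, f (Suc i)) \<in> R"
    "\<And>i j. i \<le> n \<Longrightarrow> j \<le> n \<Longrightarrow> (f i, f j) \<in> R \<Longrightarrow> j \<le> Suc i"
proof -
  define n where "n = (LEAST n. (x, y) \<in> R ^^ n)"
  have "\<exists>n. (x, y) \<in> R ^^ n" using assms by (simp add: rtrancl_power)
  then have "(x, y) \<in> R ^^ n" unfolding n_def by (rule LeastI_ex)
  then obtain f where f: "f 0 = x" "f n = y" "\<And>i. i < n \<Longrightarrow> (f i, f (Suc i)) \<in> R"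
    by (auto simp: relpow_fun_conv)
  have least: "n \<le> m" if "(x, y) \<in> R ^^ m" for m
    unfolding n_def using that by (rule Least_le)
  have pre: "(x, f i) \<in> R ^^ i" if "i \<le> n" for i
    using that f by (auto simp: relpow_fun_conv intro!: exI[of _ f])
  have post: "(f j, y) \<in> R ^^ (n - j)" if "j \<le> n" for j
    using that f by (auto simp: relpow_fun_conv intro!: exI[of _ "\<lambda>i. f (j + i)"])
  have chordless: "j \<le> Suc i" if "i \<le> n" "j \<le> n" "(f i, f j) \<in> R" for i j
  proof -
    have "(x, f j) \<in> R ^^ Suc i" using pre[OF that(1)] that(3) by auto
    then have "(x, y) \<in> R ^^ (Suc i + (n - j))"
      unfolding relpow_add using post[OF that(2)] by (rule relcompI)
    from least[OF this] that show ?thesis by linarith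
  qed
  have "j \<le> i" if "i \<le> n" "j \<le> n" "f i = f j" for i j
  proof -
    have "(x, y) \<in> R ^^ (i + (n - j))"
      unfolding relpow_add using pre[OF that(1)] post[OF that(2)] that(3) by auto
    from least[OF this] that show ?thesis by linarith
  qed
  then have "inj_on f {..n}" by (auto simp: inj_on_def intro: le_antisym)
  with f chordless show ?thesis by (intro that)
qed

text \<open>An apex adjacent to just the two ends closes a chordless path to a cycle of length
  \<open>n + 2\<close>. Symmetry of the graph turns the one-sided bound \<open>chordless\<close>
  into the absence of chords in both directions.\<close>

lemma (in pair_graph) induced_cycle_of_chordless_path:
  assumes "f 0 = x" "f n = y" "inj_on f {..n}" "f ` {..n} \<subseteq> pverts G" "v \<in> pverts G" "1 \<le> n"
    and adj: "\<And>i. i < n \<Longrightarrow> (f i, f (Suc i)) \<in> parcs G"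
    and chordless: "\<And>i j. i \<le> n \<Longrightarrow> j \<le> n \<Longrightarrow> (f i, f j) \<in> parcs G \<Longrightarrow> j \<le> Suc i"
    and apex: "\<And>i. i \<le> n \<Longrightarrow> (v, f i) \<in> parcs G \<longleftrightarrow> i = 0 \<or> i = n" "v \<notin> f ` {..n}"
  shows "induced_cycle G (v # map f [0..<Suc n])"
proof -
  let ?vs = "v # map f [0..<Suc n]"
  have path: "(f i, f j) \<in> parcs G \<longleftrightarrow> j = Suc i \<or> i = Suc j" if "i \<le> n" "j \<le> n" for i j
  proof
    assume a: "(f i, f j) \<in> parcs G"
    then have "i \<noteq> j" using no_loops' by auto
    moreover have "j \<le> Suc i" "i \<le> Suc j"
      using chordless that a arcs_symmetric by blast+
    ultimately show "j = Suc i \<or> i = Suc j" by linarith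
  next
    assume "j = Suc i \<or> i = Suc j"
    then show "(f i, f j) \<in> parcs G" using adj that arcs_symmetric by auto
  qed
  have apex': "(f i, v) \<in> parcs G \<longleftrightarrow> i = 0 \<or> i = n" if "i \<le> n" for i
    using apex(1)[OF that] arcs_symmetric by blast
  have nth: "?vs ! Suc i = f i" if "i \<le> n" for i
    using that nth_map[of i "[0..<Suc n]" f] by (simp del: upt_Suc)
  \<comment> \<open>The apex has index 0 and \<open>f i\<close> has index \<open>Suc i\<close>, so
    the last index \<open>n + 1\<close>, where the cycle wraps around, belongs to the end
    \<open>f n\<close>.\<close>
  have "(?vs ! i, ?vs ! j) \<in> parcs G \<longleftrightarrow> j = Suc i mod length ?vs \<or> i = Suc j mod length ?vs"
    if "i < n + 2" "j < n + 2" for i j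
  proof (cases i; cases j)
    assume "i = 0" "j = 0"
    then show ?thesis using no_loops' by auto
  next
    fix j' assume j: "i = 0" "j = Suc j'"
    then have "j' \<le> n" using that by simp
    then show ?thesis using j apex(1)[of j'] nth[of j'] \<open>1 \<le> n\<close>
      by (auto simp: mod_Suc simp del: upt_Suc)
  next
    fix i' assume i: "i = Suc i'" "j = 0"
    then have "i' \<le> n" using that by simp
    then show ?thesis using i apex'[of i'] nth[of i'] \<open>1 \<le> n\<close>
      by (auto simp: mod_Suc simp del: upt_Suc)
  next
    fix i' j' assume ij: "i = Suc i'" "j = Suc j'"
    then have "i' \<le> n" "j' \<le> n" using that by simp_all
    then show ?thesis using ij path[of i' j'] nth[of i'] nth[of j']
      by (auto simp: mod_Suc simp del: upt_Suc)
  qed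
  moreover have "distinct ?vs"
    using assms(3) apex(2)
    by (auto simp: distinct_map atLeast0LessThan lessThan_Suc_atMost simp del: upt_Suc)
  moreover have "set ?vs \<subseteq> pverts G"
    using assms(4,5) by (auto simp: image_subset_iff)
  ultimately show ?thesis
    using \<open>1 \<le> n\<close> unfolding induced_cycle_def by (simp del: upt_Suc)
qed

text \<open>Dirac's separator argument, meant for a component \<open>C\<close> of the non-neighbours
  of \<open>v\<close> and its boundary \<open>S\<close>: a shortest path through \<open>C\<close>
  between two non-adjacent members of \<open>S\<close> would be closed by \<open>v\<close> to an
  induced cycle of length at least 4.\<close>

lemma (in pair_graph) chordal_component_boundary_clique:
  assumes "chordal G" "v \<in> pverts G" "C \<subseteq> pverts G" "v \<notin> C"
    and nonadj: "\<And>w. w \<in> C \<Longrightarrow> (v, w) \<notin> parcs G"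
    and conn: "\<And>w w'. w \<in> C \<Longrightarrow> w' \<in> C \<Longrightarrow> (w, w') \<in> (parcs G \<inter> C \<times> C)\<^sup>*"
    and S: "\<And>s. s \<in> S \<Longrightarrow> (v, s) \<in> parcs G \<and> (\<exists>w \<in> C. (w, s) \<in> parcs G)"
  shows "clique G S"
proof -
  have "(x, y) \<in> parcs G" if xy: "x \<in> S" "y \<in> S" "x \<noteq> y" for x y
  proof (rule ccontr)
    assume nxy: "(x, y) \<notin> parcs G"
    obtain a b where ab: "a \<in> C" "b \<in> C" "(x, a) \<in> parcs G" "(b, y) \<in> parcs G"
      using S[OF xy(1)] S[OF xy(2)] arcs_symmetric by blast
    \<comment> \<open>A simple path from \<open>x\<close> to \<open>y\<close> within
      \<open>U\<close> has all its inner vertices in \<open>C\<close>, so \<open>v\<close> is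
      adjacent to none of them.\<close>
    define U where "U = insert x (insert y C)"
    define R where "R = parcs G \<inter> U \<times> U"
    have "(a, b) \<in> R\<^sup>*"
      using conn[OF ab(1,2)] rtrancl_mono[of "parcs G \<inter> C \<times> C" R] by (auto simp: R_def U_def)
    moreover have "(x, a) \<in> R" "(b, y) \<in> R" using ab by (auto simp: R_def U_def)
    ultimately have "(x, y) \<in> R\<^sup>*" by (meson converse_rtrancl_into_rtrancl rtrancl.rtrancl_into_rtrancl)
    then obtain f n where f: "f 0 = x" "f n = y" "inj_on f {..n}"
      "\<And>i. i < n \<Longrightarrow> (f i, f (Suc i)) \<in> R"
      "\<And>i j. i \<le> n \<Longrightarrow> j \<le> n \<Longrightarrow> (f i, f j) \<in> R \<Longrightarrow> j \<le> Suc i"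
      by (rule rtrancl_shortest_path) blast
    \<comment> \<open>Length 0 would mean \<open>x = y\<close> and length 1 would make
      \<open>x\<close> and \<open>y\<close> adjacent; with \<open>n\<close> at least 2 the cycle has
      at least 4 vertices.\<close>
    have "n \<noteq> 0" using f xy by metis
    moreover have "n \<noteq> 1" using f(1,2) f(4)[of 0] nxy by (auto simp: R_def)
    ultimately have n: "2 \<le> n" by linarith
    have fU: "f i \<in> U" if "i \<le> n" for i
      using that f(1) f(4)[of "i - 1"] by (cases i) (auto simp: R_def U_def)
    have fC: "f i \<in> C" if "i \<le> n" "i \<noteq> 0" "i \<noteq> n" for i
    proof -
      have "f i \<noteq> f 0" "f i \<noteq> f n"
        using inj_on_contraD[OF f(3), of i] that by auto
      then show ?thesis using fU[OF that(1)] f(1,2) by (auto simp: U_def)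
    qed
    have "induced_cycle G (v # map f [0..<Suc n])"
    proof (rule induced_cycle_of_chordless_path[OF f(1-3)])
      have "U \<subseteq> pverts G" using assms(3) S xy in_arcsD2 by (auto simp: U_def)
      then show "f ` {..n} \<subseteq> pverts G" using fU by auto
      show "v \<in> pverts G" "1 \<le> n" using assms(2) n by auto
      show "(f i, f (Suc i)) \<in> parcs G" if "i < n" for i using f(4)[OF that] by (simp add: R_def)
      show "j \<le> Suc i" if "i \<le> n" "j \<le> n" "(f i, f j) \<in> parcs G" for i j
        using f(5) that fU by (auto simp: R_def)
      show "(v, f i) \<in> parcs G \<longleftrightarrow> i = 0 \<or> i = n" if "i \<le> n" for i
        using fC[OF that] nonadj S xy f(1,2) by auto
      have "v \<notin> U" using assms(4) S xy no_loops' by (auto simp: U_def)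
      then show "v \<notin> f ` {..n}" using fU by auto
    qed
    then show False using \<open>chordal G\<close> n unfolding chordal_def by fastforce
  qed
  moreover have "S \<subseteq> pverts G" using S in_arcsD2 by blast
  ultimately show ?thesis unfolding clique_def by blast
qed

text \<open>Dirac's theorem relative to an induced subgraph and a clique to be avoided. Keeping the
  clique arbitrary makes the induction on \<open>U\<close> work, since the boundary \<open>S\<close>
  of a component takes over the role of \<open>X\<close>.\<close>

lemma (in pair_graph) chordal_simplicial_outside_clique:
  assumes "chordal G" "U \<subseteq> pverts G" "clique G X" "X \<subset> U"
  shows "\<exists>u \<in> U - X. clique G {w \<in> U. (u, w) \<in> parcs G}"
proof -
  have "finite U" using assms(2) pair_finite_verts by (rule finite_subset)
  then show ?thesis using assms(2-)
  proof (induction U arbitrary: X rule: finite_psubset_induct)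
    case (psubset U)
    \<comment> \<open>Nonemptiness makes \<open>U - X\<close> smaller than \<open>U\<close> when
      \<open>X\<close> is deleted; the empty clique is reduced to a singleton afterwards.\<close>
    have nonempty: "\<exists>u \<in> U - X. clique G {w \<in> U. (u, w) \<in> parcs G}"
      if X: "X \<noteq> {}" "X \<subset> U" "clique G X" for X
    proof (cases "\<exists>x \<in> X. \<exists>c \<in> U. c \<noteq> x \<and> (x, c) \<notin> parcs G")
      case True
      then obtain x c where x: "x \<in> X" "c \<in> U" "c \<noteq> x" "(x, c) \<notin> parcs G" by blast
      \<comment> \<open>\<open>W\<close> consists of the non-neighbours of \<open>x\<close> in
        \<open>U\<close>, \<open>C\<close> is the component of \<open>c\<close> in it, and
        \<open>S\<close> is the boundary of \<open>C\<close> in \<open>U\<close>.\<close>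
      define W where "W = {w \<in> U. w \<noteq> x \<and> (x, w) \<notin> parcs G}"
      define C where "C = {w. (c, w) \<in> (parcs G \<inter> W \<times> W)\<^sup>*}"
      define S where "S = {s \<in> U - C. \<exists>w \<in> C. (w, s) \<in> parcs G}"
      have c: "c \<in> C" "c \<in> W" using x by (auto simp: C_def W_def)
      have CW: "C \<subseteq> W" using c(2) by (auto simp: C_def elim: rtranclE)
      \<comment> \<open>A path in \<open>W\<close> from \<open>c\<close> never leaves
        \<open>C\<close>, so \<open>C\<close> is connected by arcs of its own.\<close>
      have reach: "(c, w) \<in> (parcs G \<inter> C \<times> C)\<^sup>*" if "w \<in> C" for w
        using that[unfolded C_def, simplified]
      proof (induction rule: rtrancl_induct)
        case (step y z)
        then have "y \<in> C" "z \<in> C" by (auto simp: C_def intro: rtrancl_into_rtrancl)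
        with step show ?case by (auto intro: rtrancl_into_rtrancl)
      qed simp
      have "sym (parcs G \<inter> C \<times> C)" using arcs_symmetric by (auto simp: sym_def)
      then have "sym ((parcs G \<inter> C \<times> C)\<^sup>*)" by (rule sym_rtrancl)
      then have conn: "(w, w') \<in> (parcs G \<inter> C \<times> C)\<^sup>*" if "w \<in> C" "w' \<in> C" for w w'
        using reach that by (meson rtrancl_trans symD)
      have "clique G S"
      proof (rule chordal_component_boundary_clique[OF \<open>chordal G\<close> _ _ _ _ conn])
        show "x \<in> pverts G" using x X psubset.prems by blast
        show "C \<subseteq> pverts G" using CW psubset.prems by (auto simp: W_def)
        show "x \<notin> C" "\<And>w. w \<in> C \<Longrightarrow> (x, w) \<notin> parcs G" using CW by (auto simp: W_def)
        show "(x, s) \<in> parcs G \<and> (\<exists>w \<in> C. (w, s) \<in> parcs G)" if s: "s \<in> S" for s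
        proof -
          obtain w where w: "w \<in> C" "(w, s) \<in> parcs G" using s by (auto simp: S_def)
          \<comment> \<open>A neighbour of \<open>C\<close> inside \<open>W\<close> would belong to
            the component; hence a boundary vertex, being different from \<open>x\<close>, is a
            neighbour of \<open>x\<close>.\<close>
          have "s \<notin> W"
          proof
            assume "s \<in> W"
            then have "(w, s) \<in> parcs G \<inter> W \<times> W" using w CW by auto
            then have "s \<in> C" using w(1) by (auto simp: C_def intro: rtrancl_into_rtrancl)
            then show False using s by (auto simp: S_def)
          qed
          moreover have "s \<noteq> x" using w CW arcs_symmetric by (auto simp: W_def)
          ultimately show ?thesis using s w by (auto simp: S_def W_def)
        qed
      qed
      \<comment> \<open>The vertex \<open>x\<close> of \<open>U\<close> is outside \<open>C\<close>
        and has no neighbour in \<open>C\<close>, so the induction hypothesis applies to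
        \<open>C \<union> S\<close> with \<open>S\<close> as the clique to avoid.\<close>
      moreover have "C \<union> S \<subset> U"
      proof -
        have "x \<notin> C \<union> S" using CW arcs_symmetric by (auto simp: S_def W_def)
        then show ?thesis using CW x X by (auto simp: S_def W_def)
      qed
      moreover have "S \<subset> C \<union> S" using c by (auto simp: S_def)
      ultimately obtain u where u: "u \<in> C \<union> S - S" "clique G {w \<in> C \<union> S. (u, w) \<in> parcs G}"
        using psubset.IH[of "C \<union> S" S] psubset.prems by blast
      \<comment> \<open>All neighbours of \<open>u\<close> in \<open>U\<close> lie in
        \<open>C\<close> or its boundary, so \<open>u\<close> stays simplicial in \<open>U\<close>.
        It avoids \<open>X\<close> because it is a non-neighbour of \<open>x\<close>, while
        \<open>X\<close> is a clique containing \<open>x\<close>.\<close>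
      have "u \<in> C" using u by blast
      then have "u \<in> W" "{w \<in> U. (u, w) \<in> parcs G} = {w \<in> C \<union> S. (u, w) \<in> parcs G}"
        using CW by (auto simp: S_def W_def)
      moreover from \<open>u \<in> W\<close> have "u \<in> U" "u \<notin> X" using X x by (auto simp: W_def clique_def)
      ultimately show ?thesis using u by (intro bexI[of _ u]) simp_all
    next
      case False
      \<comment> \<open>Now each vertex of \<open>X\<close> is adjacent to all others in
        \<open>U\<close>, so putting \<open>X\<close> back keeps the neighbourhood of a simplicial
        vertex of \<open>U - X\<close> a clique.\<close>
      have "U - X \<subset> U" "{} \<subset> U - X" using X by auto
      then obtain u where u: "u \<in> U - X" "clique G {w \<in> U - X. (u, w) \<in> parcs G}"
        using psubset.IH[of "U - X" "{}"] psubset.prems by (auto simp: clique_def)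
      have univ: "(x, w) \<in> parcs G" "(w, x) \<in> parcs G" if "x \<in> X" "w \<in> U" "w \<noteq> x" for x w
        using False that arcs_symmetric by blast+
      have "(a, b) \<in> parcs G"
        if "a \<in> U" "b \<in> U" "(u, a) \<in> parcs G" "(u, b) \<in> parcs G" "a \<noteq> b" for a b
        using that univ[of a b] univ[of b a] u(2) by (cases "a \<in> X \<or> b \<in> X") (auto simp: clique_def)
      then have "clique G {w \<in> U. (u, w) \<in> parcs G}"
        using psubset.prems by (auto simp: clique_def)
      then show ?thesis using u by blast
    qed
    show ?case
    proof (cases "X = {}")
      case True
      then obtain v where v: "v \<in> U" using psubset.prems by blast
      then have "clique G {v}" using psubset.prems by (auto simp: clique_def)
      show ?thesis
      proof (cases "U = {v}")
        case True
        then have "{w \<in> U. (v, w) \<in> parcs G} = {}" using no_loops' by auto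
        then show ?thesis using v \<open>X = {}\<close> by (auto simp: clique_def)
      next
        case False
        then show ?thesis using nonempty[of "{v}"] v \<open>clique G {v}\<close> \<open>X = {}\<close> by auto
      qed
    next
      case False
      then show ?thesis using nonempty psubset.prems by blast
    qed
  qed
qed

text \<open>A perfect elimination order read backwards: simplicial vertices outside \<open>X\<close>
  are peeled off \<open>U\<close> until only \<open>X\<close> remains.\<close>

lemma (in pair_graph) chordal_elimination_induct [consumes 4, case_names clique simplicial]:
  assumes "chordal G" "clique G X" "X \<subseteq> U" "U \<subseteq> pverts G"
    and base: "P X"
    and step: "\<And>v U. X \<subseteq> U \<Longrightarrow> v \<in> pverts G - U \<Longrightarrow> U \<subseteq> pverts G \<Longrightarrow>
      clique G {w \<in> U. (v, w) \<in> parcs G} \<Longrightarrow> P U \<Longrightarrow> P (insert v U)"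
  shows "P U"
proof -
  have "finite U" using assms(4) pair_finite_verts by (rule finite_subset)
  then show ?thesis using assms(3,4)
  proof (induction U rule: finite_psubset_induct)
    case (psubset U)
    show ?case
    proof (cases "X = U")
      case False
      then obtain u where u: "u \<in> U - X" "clique G {w \<in> U. (u, w) \<in> parcs G}"
        using chordal_simplicial_outside_clique[OF assms(1) psubset.prems(2) assms(2)] psubset.prems
        by blast
      have "clique G {w \<in> U - {u}. (u, w) \<in> parcs G}" using u(2) by (auto simp: clique_def)
      moreover have "P (U - {u})" using u psubset by auto
      ultimately have "P (insert u (U - {u}))" using u psubset.prems by (intro step) auto
      then show ?thesis using u by (simp add: insert_absorb)
    qed (use base in simp)
  qed
qed

section \<open>Adding a common prey to a digraph\<close>

text \<open>Working on a bare arc relation spares the gluing argument a vertex set that grows at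
  each step.\<close>

definition competition :: "'b rel \<Rightarrow> 'b rel" where
  "competition A = {(x, y). x \<noteq> y \<and> (\<exists>w. (x, w) \<in> A \<and> (y, w) \<in> A)}"

text \<open>The predators of \<open>t\<close> become exactly \<open>K\<close>, and those of any
  other vertex do not change.\<close>

lemma competition_add_prey:
  assumes "t \<notin> Range A"
  shows "competition (A \<union> K \<times> {t}) = competition A \<union> (K \<times> K - Id)"
  using assms by (auto simp: competition_def)

text \<open>Since \<open>t\<close> is a sink of the enlarged relation, no cycle passes through it,
  and a cycle avoiding \<open>t\<close> lies in \<open>A\<close>.\<close>

lemma acyclic_add_prey:
  assumes "acyclic A" "t \<notin> Domain A" "t \<notin> K"
  shows "acyclic (A \<union> K \<times> {t})"
proof -
  have "(x, y) \<in> A\<^sup>+ \<or> y = t" "x \<noteq> t" if "(x, y) \<in> (A \<union> K \<times> {t})\<^sup>+" for x y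
    using that
    by (induction rule: trancl_induct) (use assms in \<open>auto intro: trancl_into_trancl\<close>)
  then show ?thesis using assms(1) unfolding acyclic_def by blast
qed

section \<open>Competition numbers in terms of arc relations\<close>

lemma parcs_competition_graph:
  assumes "parcs D \<subseteq> pverts D \<times> pverts D"
  shows "parcs (competition_graph D) = competition (parcs D)"
  using assms by (auto simp: competition_graph_def competition_def)

lemma competition_number_le:
  assumes "finite V" "A \<subseteq> V \<times> V" "V = pverts G <+> {..<k}" "acyclic A"
    "competition A = map_prod Inl Inl ` parcs G"
  shows "competition_number G \<le> k"
  unfolding competition_number_def
proof (rule Least_le, intro exI conjI)
  let ?D = "\<lparr>pverts = V, parcs = A\<rparr>"
  show "pair_fin_digraph ?D"
    using assms(1,2) by unfold_locales (auto intro: finite_subset)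
  show "acyclic (parcs ?D)" using assms(4) by simp
  have "parcs (competition_graph ?D) = map_prod Inl Inl ` parcs G"
    using assms(2,5) by (simp add: parcs_competition_graph)
  then show "competition_graph ?D = add_isolated k G"
    using assms(3) by (simp add: competition_graph_def add_isolated_def)
qed

lemma competition_number_attained:
  assumes "pair_graph G"
  obtains A where
    "A \<subseteq> (pverts G <+> {..<competition_number G}) \<times> (pverts G <+> {..<competition_number G})"
    "acyclic A" "competition A = map_prod Inl Inl ` parcs G"
proof -
  have "\<exists>D. pair_fin_digraph D \<and> acyclic (parcs D) \<and>
      competition_graph D = add_isolated (competition_number G) G"
    unfolding competition_number_def by (rule LeastI_ex) (rule competition_number_exists[OF assms])
  then obtain D where D: "pair_fin_digraph D" "acyclic (parcs D)"
    "competition_graph D = add_isolated (competition_number G) G" by blast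
  have verts: "pverts D = pverts G <+> {..<competition_number G}"
    using arg_cong[OF D(3), of pverts] by (simp add: competition_graph_def add_isolated_def)
  interpret D: pair_fin_digraph D by (rule D(1))
  have sub: "parcs D \<subseteq> pverts D \<times> pverts D"
    using D.in_arcsD1 D.in_arcsD2 by auto
  have "competition (parcs D) = map_prod Inl Inl ` parcs G"
    using parcs_competition_graph[OF sub] D(3) by (simp add: add_isolated_def)
  then show ?thesis using that D(2) sub verts by simp
qed

section \<open>Attaching a chordal graph along a clique\<close>

text \<open>The sink \<open>t\<close> stays variable throughout the induction, so a vertex about to
  be added can itself be chosen as the sink of the previous stage. By the condition on
  \<open>X\<close>, vertices of the chordal graph outside \<open>X\<close> do not yet occur in
  \<open>V\<close>.\<close>

lemma competition_extend_chordal: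
  fixes G\<^sub>2 :: "'a pair_pre_digraph" and V :: "('a + nat) set"
  assumes "pair_graph G\<^sub>2" "chordal G\<^sub>2" "clique G\<^sub>2 X" "X \<subseteq> U" "U \<subseteq> pverts G\<^sub>2"
    and A: "A \<subseteq> V \<times> V" "acyclic A" "competition A = map_prod Inl Inl ` E"
    and X: "X = {x \<in> pverts G\<^sub>2. Inl x \<in> V}"
    and "t \<notin> V \<union> Inl ` U"
  obtains B where "B \<subseteq> (V \<union> Inl ` U) \<times> insert t (V \<union> Inl ` U)" "acyclic B"
    "competition B = map_prod Inl Inl ` (E \<union> (parcs G\<^sub>2 \<inter> U \<times> U))"
proof -
  interpret G\<^sub>2: pair_graph G\<^sub>2 by fact
  have "\<exists>B. B \<subseteq> (V \<union> Inl ` U) \<times> insert t (V \<union> Inl ` U) \<and> acyclic B \<and>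
      competition B = map_prod Inl Inl ` (E \<union> (parcs G\<^sub>2 \<inter> U \<times> U))"
    using assms(2-5,10)
  proof (induction U arbitrary: t rule: G\<^sub>2.chordal_elimination_induct)
    case clique
    \<comment> \<open>Preying on \<open>t\<close> joins all pairs in \<open>X\<close>, and as
      \<open>X\<close> is a clique these are the arcs of \<open>G\<^sub>2\<close> within
      \<open>X\<close>.\<close>
    let ?B = "A \<union> Inl ` X \<times> {t}"
    have XV: "Inl ` X \<subseteq> V" using X by auto
    have "t \<notin> Range A" "t \<notin> Domain A" "t \<notin> Inl ` X" using clique A(1) by auto
    moreover have "Inl ` X \<times> Inl ` X - Id =
        (map_prod Inl Inl ` (parcs G\<^sub>2 \<inter> X \<times> X) :: ('a + nat) rel)"
    proof -
      have "parcs G\<^sub>2 \<inter> X \<times> X = X \<times> X - Id"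
        using assms(3) G\<^sub>2.no_loops' by (auto simp: clique_def)
      then show ?thesis by auto
    qed
    ultimately have "acyclic ?B"
      "competition ?B = map_prod Inl Inl ` (E \<union> (parcs G\<^sub>2 \<inter> X \<times> X))"
      using A by (simp_all add: acyclic_add_prey competition_add_prey image_Un)
    moreover have "?B \<subseteq> (V \<union> Inl ` X) \<times> insert t (V \<union> Inl ` X)" using A(1) XV by auto
    ultimately show ?case by blast
  next
    case (simplicial v U)
    have "v \<notin> X" using simplicial.hyps by auto
    then have vV: "Inl v \<notin> V \<union> Inl ` U" using X simplicial.hyps by auto
    \<comment> \<open>The induction hypothesis is used with \<open>Inl v\<close> as the sink:
      \<open>v\<close> has prey only from now on, namely the new sink \<open>t\<close>.\<close>
    obtain B where B: "B \<subseteq> (V \<union> Inl ` U) \<times> insert (Inl v) (V \<union> Inl ` U)" "acyclic B"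
      "competition B = map_prod Inl Inl ` (E \<union> (parcs G\<^sub>2 \<inter> U \<times> U))"
      using simplicial.IH[OF vV] by blast
    \<comment> \<open>As \<open>v\<close> is simplicial, \<open>v\<close> together with
      \<open>N\<close> is a clique. Preying on \<open>t\<close> thus adds the edges from
      \<open>v\<close> to \<open>N\<close> and otherwise only repeats edges within
      \<open>U\<close>.\<close>
    define N where "N = {w \<in> U. (v, w) \<in> parcs G\<^sub>2}"
    define K :: "('a + nat) set" where "K = Inl ` insert v N"
    have "t \<notin> Range B" "t \<notin> Domain B" "t \<notin> K"
      using simplicial.prems B(1) by (auto simp: K_def N_def)
    moreover have "map_prod Inl Inl ` (parcs G\<^sub>2 \<inter> U \<times> U) \<union> (K \<times> K - Id) =
        map_prod Inl Inl ` (parcs G\<^sub>2 \<inter> insert v U \<times> insert v U)"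
    proof -
      have arc_sym: "(a, b) \<in> parcs G\<^sub>2 \<longleftrightarrow> (b, a) \<in> parcs G\<^sub>2" for a b
        using G\<^sub>2.arcs_symmetric by blast
      have "(a, b) \<in> parcs G\<^sub>2" if "a \<in> insert v N" "b \<in> insert v N" "a \<noteq> b" for a b
        using that simplicial.hyps(4) arc_sym[of v] by (auto simp: N_def clique_def)
      moreover have "insert v N \<subseteq> insert v U" by (auto simp: N_def)
      moreover have "a \<in> insert v N \<and> b \<in> insert v N \<and> a \<noteq> b"
        if "(a, b) \<in> parcs G\<^sub>2 \<inter> insert v U \<times> insert v U" "(a, b) \<notin> U \<times> U" for a b
        using that arc_sym[of a b] G\<^sub>2.no_loops' by (auto simp: N_def)
      ultimately have "(parcs G\<^sub>2 \<inter> U \<times> U) \<union> (insert v N \<times> insert v N - Id) =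
          parcs G\<^sub>2 \<inter> insert v U \<times> insert v U"
        by (intro equalityI subrelI) blast+
      moreover have "K \<times> K - Id = map_prod Inl Inl ` (insert v N \<times> insert v N - Id)"
        by (auto simp: K_def)
      ultimately show ?thesis by (metis image_Un)
    qed
    ultimately have "acyclic (B \<union> K \<times> {t})"
      "competition (B \<union> K \<times> {t}) =
        map_prod Inl Inl ` (E \<union> (parcs G\<^sub>2 \<inter> insert v U \<times> insert v U))"
      using B by (simp_all add: acyclic_add_prey competition_add_prey image_Un Un_assoc)
    moreover have "K \<subseteq> V \<union> Inl ` insert v U" by (auto simp: K_def N_def)
    then have "B \<union> K \<times> {t} \<subseteq> (V \<union> Inl ` insert v U) \<times> insert t (V \<union> Inl ` insert v U)"
      using B(1) by auto
    ultimately show ?case by blast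
  qed
  then show ?thesis using that by blast
qed

theorem theorem6:
  fixes G G\<^sub>1 G\<^sub>2 :: "'a pair_pre_digraph" and k :: nat
  assumes "pair_graph G"
    and "pair_graph G\<^sub>1" and "subgraph (with_proj G\<^sub>1) (with_proj G)"
    and "competition_number G\<^sub>1 \<le> k"
    and "pair_graph G\<^sub>2" and "subgraph (with_proj G\<^sub>2) (with_proj G)"
    and "chordal G\<^sub>2"
    and "parcs G\<^sub>1 \<union> parcs G\<^sub>2 = parcs G"
    and "clique G\<^sub>2 (pverts G\<^sub>1 \<inter> pverts G\<^sub>2)"
  shows "competition_number G \<le> k + 1"
proof -
  interpret G: pair_graph G by fact
  interpret G\<^sub>2: pair_graph G\<^sub>2 by fact
  let ?k = "competition_number G\<^sub>1"
  let ?V = "pverts G\<^sub>1 <+> {..<?k}" and ?W = "pverts G <+> {..<?k + 1}"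
  let ?U = "pverts G\<^sub>2"
  have sub: "pverts G\<^sub>1 \<subseteq> pverts G" "pverts G\<^sub>2 \<subseteq> pverts G"
    using assms(3,6) by (auto simp: subgraph_def)
  obtain A where A: "A \<subseteq> ?V \<times> ?V" "acyclic A" "competition A = map_prod Inl Inl ` parcs G\<^sub>1"
    using competition_number_attained[OF assms(2)] .
  \<comment> \<open>\<open>Inr ?k\<close> is the first index beyond the \<open>?k\<close> isolated
    vertices of the digraph for \<open>G\<^sub>1\<close>; it is the one extra vertex.\<close>
  obtain B where B: "B \<subseteq> (?V \<union> Inl ` ?U) \<times> insert (Inr ?k) (?V \<union> Inl ` ?U)" "acyclic B"
    "competition B = map_prod Inl Inl ` (parcs G\<^sub>1 \<union> (parcs G\<^sub>2 \<inter> ?U \<times> ?U))"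
    by (rule competition_extend_chordal[OF assms(5,7,9) _ _ A, of ?U "Inr ?k"]) auto
  \<comment> \<open>Only an inclusion holds in general: vertices of \<open>G\<close> in neither
    subgraph are isolated and carry no arcs of \<open>B\<close>.\<close>
  have "insert (Inr ?k) (?V \<union> Inl ` ?U) \<subseteq> ?W" using sub by auto
  then have "B \<subseteq> ?W \<times> ?W" using B(1) by blast
  moreover have "parcs G\<^sub>1 \<union> (parcs G\<^sub>2 \<inter> ?U \<times> ?U) = parcs G"
    using assms(8) G\<^sub>2.in_arcsD1 G\<^sub>2.in_arcsD2 by auto
  moreover have "finite ?W" using G.pair_finite_verts by simp
  ultimately have "competition_number G \<le> ?k + 1"
    using competition_number_le[of ?W B G "?k + 1"] B by simp
  then show ?thesis using assms(4) by simp
qed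

end
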